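(* For all nonnegative integers $n,k,m$, \[ w_{n,k,m}=\begin{cases}\dfrac{1}{k}\dbinom{n}{k-1}\dbinom{n-k-1}{m-1}\dbinom{k}{m}, & \text{if } m>0,\ m\le k,\ \text{and } k+m\le n,\\[2mm] 1, & \text{if } m=0 \text{ and } n=k,\\ 0, & \text{otherwise.}\end{cases} \]
   Context: A Dyck path of semilength $n$ is a word in the letters $U,D$ with $n$ copies of each letter such that no prefix contains more $D$'s than $U$'s. A $UD$-factor (resp. $UUD$-factor) is an occurrence of $UD$ (resp. $UUD$) as a consecutive subword. $w_{n,k,m}$ denotes the number of Dyck paths of semilength $n$ with exactly $k$ $UD$-factors and exactly $m$ $UUD$-factors. *)

theory Defs
  imports Complex_Main "HOL-Library.Sublist"
begin

datatype step = U | D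

definition dyck_path :: "nat \<Rightarrow> step list \<Rightarrow> bool" where
  "dyck_path n w \<longleftrightarrow>
     count_list w U = n \<and> count_list w D = n \<and>
     (\<forall>p. prefix p w \<longrightarrow> count_list p D \<le> count_list p U)"

(* An occurrence of f as a consecutive subword of w is a factorization w = p @ f @ s;
   distinct occurrences have distinct pairs (p, s). *)
definition factor_count :: "'a list \<Rightarrow> 'a list \<Rightarrow> nat" where
  "factor_count f w = card {(p, s). w = p @ f @ s}"

definition dyck_count :: "nat \<Rightarrow> nat \<Rightarrow> nat \<Rightarrow> nat" where
  "dyck_count n k m =
     card {w. dyck_path n w \<and> factor_count [U, D] w = k \<and> factor_count [U, U, D] w = m}"

end

theory Submission
  imports Defs
begin

text \<open>
  Let \<open>k \<ge> 1\<close> and append one \<open>D\<close> to a Dyck path with \<open>k\<close> peaks. The result is a concatenation of \<open>k\<close>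
  blocks \<open>U\<^sup>a D\<^sup>b\<close> with \<open>a, b > 0\<close>, the \<open>a\<close>'s summing to \<open>n\<close> and the \<open>b\<close>'s to \<open>n + 1\<close>, and
  \<open>m\<close> counts the blocks with \<open>a \<ge> 2\<close>. The block weights \<open>a - b\<close> sum to \<open>-1\<close>, and the path condition
  says that all proper prefix sums are nonnegative. By the cycle lemma exactly one of the \<open>k\<close> rotations of
  an arbitrary block sequence satisfies it, so \<open>k * w\<^bsub>n,k,m\<^esub>\<close> is the number of pairs of independent
  compositions: \<open>(k choose m) * (n-k-1 choose m-1)\<close> choices for the \<open>a\<close>'s and
  \<open>n choose (k-1)\<close> choices for the \<open>b\<close>'s.
\<close>

section \<open>The cycle lemma\<close>

text \<open>Only strict prefixes are tested, because the lists of interest have total weight -1. The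
  starting height \<open>h\<close> lets inductions consume the list from the left.\<close>

definition nonneg_prefixes :: "('a \<Rightarrow> int) \<Rightarrow> int \<Rightarrow> 'a list \<Rightarrow> bool" where
  "nonneg_prefixes f h xs \<longleftrightarrow> (\<forall>u. strict_prefix u xs \<longrightarrow> 0 \<le> h + sum_list (map f u))"

lemma nonneg_prefixes_Nil [simp]: "nonneg_prefixes f h []"
  by (simp add: nonneg_prefixes_def)

lemma nonneg_prefixes_Cons [simp]:
  "nonneg_prefixes f h (x # xs) \<longleftrightarrow> 0 \<le> h \<and> nonneg_prefixes f (h + f x) xs"
proof -
  have "strict_prefix u (x # xs) \<longleftrightarrow> u = [] \<or> (\<exists>v. u = x # v \<and> strict_prefix v xs)" for u
    by (cases u) auto
  then show ?thesis
    unfolding nonneg_prefixes_def by (auto simp: add.assoc)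
qed

text \<open>Each of \<open>u\<close> and \<open>v\<close> is a proper prefix of one of the two
  rotations. For total weight -1 the conclusion is absurd, which makes the good rotation
  unique.\<close>

lemma nonneg_prefixes_append_rotate_unique:
  assumes "nonneg_prefixes f 0 (u @ v)" "nonneg_prefixes f 0 (v @ u)"
    and "u \<noteq> []" "v \<noteq> []"
  shows "0 \<le> sum_list (map f (u @ v))"
proof -
  have "strict_prefix u (u @ v)" "strict_prefix v (v @ u)"
    using assms(3,4) by (auto simp: strict_prefix_def)
  then have "0 \<le> sum_list (map f u)" "0 \<le> sum_list (map f v)"
    using assms(1,2) unfolding nonneg_prefixes_def by auto
  then show ?thesis by simp
qed

text \<open>Cut \<open>xs\<close> at the first position where its partial sums reach their
  minimum.\<close>

lemma ex_rotate_nonneg_prefixes: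
  assumes "sum_list (map f xs) = -1"
  shows "\<exists>i. nonneg_prefixes f 0 (rotate i xs)"
proof -
  define S where "S i = sum_list (map f (take i xs))" for i
  define M where "M = Min (S ` {..length xs})"
  have "M \<in> S ` {..length xs}"
    unfolding M_def by (rule Min_in) auto
  then have ex: "\<exists>i. i \<le> length xs \<and> S i = M" by auto
  \<comment> \<open>Taking the first minimum makes all earlier partial sums strictly larger; this
    gap pays for the total weight -1 once a prefix wraps around.\<close>
  define i where "i = (LEAST i. i \<le> length xs \<and> S i = M)"
  have i: "i \<le> length xs" "S i = M"
    using LeastI_ex[OF ex] unfolding i_def by auto
  have min: "M \<le> S j" if "j \<le> length xs" for j
    unfolding M_def using that by (intro Min_le) auto
  have first: "M < S j" if "j < i" for j
    using not_less_Least[of j "\<lambda>i. i \<le> length xs \<and> S i = M"] that i min[of j]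
    unfolding i_def[symmetric] by force
  have split: "S i + sum_list (map f (drop i xs)) = -1"
    using assms unfolding S_def
    by (metis append_take_drop_id map_append sum_list_append)
  have "nonneg_prefixes f 0 (drop i xs @ take i xs)"
    unfolding nonneg_prefixes_def
  proof (intro allI impI)
    fix u assume u: "strict_prefix u (drop i xs @ take i xs)"
    then have pre: "prefix u (drop i xs @ take i xs)" by auto
    from u have len: "length u < length xs"
      using prefix_length_less[OF u] by simp
    show "0 \<le> 0 + sum_list (map f u)"
    \<comment> \<open>A prefix \<open>u\<close> inside \<open>drop i xs\<close> has sum
      \<open>S (i + length u) - M\<close>; one that wraps around to position \<open>j < i\<close>
      has sum \<open>-1 - M + S j\<close>, nonnegative because \<open>M < S j\<close> over the
      integers.\<close>
    proof (cases "length u \<le> length (drop i xs)")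
      case True
      have eq: "u = take (length u) (drop i xs)"
        using pre True by (auto simp: prefix_def append_eq_append_conv2)
      have "S (i + length u) = S i + sum_list (map f u)"
        unfolding S_def take_add by (subst eq) simp
      moreover have "M \<le> S (i + length u)"
        using True i by (intro min) auto
      ultimately show ?thesis using i by simp
    next
      case False
      define j where "j = length u - length (drop i xs)"
      have "j < i" using False len i unfolding j_def by auto
      from pre obtain z where "drop i xs @ take i xs = u @ z" by (auto simp: prefix_def)
      then obtain v where v: "u = drop i xs @ v" "take i xs = v @ z"
        using False by (auto simp: append_eq_append_conv2 dest: arg_cong[where f = length])
      then have "v = take j (take i xs)" by (simp add: j_def)
      with v(1) \<open>j < i\<close> have eq: "u = drop i xs @ take j xs" by (simp add: min_def)
      from first[OF \<open>j < i\<close>] split i show ?thesis by (simp add: eq S_def)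
    qed
  qed
  \<comment> \<open>\<open>rotate_drop_take\<close> reduces \<open>i\<close> modulo the length, so a
    first minimum at the very end of the list is treated apart.\<close>
  moreover have "rotate i xs = drop i xs @ take i xs" if "i < length xs"
    using that by (simp add: rotate_drop_take)
  moreover have "rotate i xs = drop i xs @ take i xs" if "i = length xs"
    using that by simp
  ultimately show ?thesis using i by (metis le_neq_implies_less)
qed

text \<open>Rotation maps pairs of an offset below \<open>k\<close> and a good list bijectively onto
  \<open>T\<close>: existence of a good rotation gives surjectivity, its uniqueness
  injectivity.\<close>

lemma cycle_lemma:
  assumes "finite T"
    and len: "\<And>xs. xs \<in> T \<Longrightarrow> length xs = k"
    and weight: "\<And>xs. xs \<in> T \<Longrightarrow> sum_list (map f xs) = -1"
    and closed: "\<And>xs i. xs \<in> T \<Longrightarrow> rotate i xs \<in> T"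
  shows "card T = k * card {xs \<in> T. nonneg_prefixes f 0 xs}"
proof -
  define G where "G = {xs \<in> T. nonneg_prefixes f 0 xs}"
  \<comment> \<open>Cancelling \<open>rotate i\<close> leaves \<open>xs\<close> as the rotation of
    \<open>ys\<close> by \<open>j - i < k\<close>. If this offset is nonzero, both pieces of the cut
    are nonempty and two good rotations contradict the weight -1.\<close>
  have aux: "i = j \<and> xs = ys"
    if "i \<le> j" "j < k" "xs \<in> G" "ys \<in> G" "rotate i xs = rotate j ys" for i j xs ys
  proof -
    have "rotate i xs = rotate i (rotate (j - i) ys)"
      using that by (simp add: rotate_rotate)
    moreover have "inj (rotate i :: 'a list \<Rightarrow> 'a list)"
      unfolding rotate_def using inj_rotate1 by (rule inj_fn)
    ultimately have xs: "xs = rotate (j - i) ys" by (auto dest: injD)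
    have "i = j"
    proof (rule ccontr)
      assume "i \<noteq> j"
      have ly: "length ys = k" using that len by (auto simp: G_def)
      let ?u = "take (j - i) ys" and ?v = "drop (j - i) ys"
      have "xs = ?v @ ?u"
        using xs that ly by (simp add: rotate_drop_take)
      then have "0 \<le> sum_list (map f (?u @ ?v))"
        using that ly \<open>i \<noteq> j\<close>
        by (intro nonneg_prefixes_append_rotate_unique) (auto simp: G_def)
      then show False using weight[of ys] that by (simp add: G_def)
    qed
    with xs show ?thesis by simp
  qed
  have "bij_betw (\<lambda>(i, xs). rotate i xs) ({..<k} \<times> G) T"
    unfolding bij_betw_def
  proof
    show "inj_on (\<lambda>(i, xs). rotate i xs) ({..<k} \<times> G)"
    proof (rule inj_onI)
      fix p q
      assume pq: "p \<in> {..<k} \<times> G" "q \<in> {..<k} \<times> G"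
        "(case p of (i, xs) \<Rightarrow> rotate i xs) = (case q of (i, xs) \<Rightarrow> rotate i xs)"
      obtain i xs j ys where p: "p = (i, xs)" "q = (j, ys)" by (metis surj_pair)
      with pq have *: "i < k" "xs \<in> G" "j < k" "ys \<in> G" "rotate i xs = rotate j ys"
        by auto
      show "p = q"
      proof (cases "i \<le> j")
        case True
        then show ?thesis using aux[of i j xs ys] * p by auto
      next
        case False
        then show ?thesis using aux[of j i ys xs] * p by auto
      qed
    qed
    show "(\<lambda>(i, xs). rotate i xs) ` ({..<k} \<times> G) = T"
    proof
      show "(\<lambda>(i, xs). rotate i xs) ` ({..<k} \<times> G) \<subseteq> T"
        using closed by (auto simp: G_def)
      show "T \<subseteq> (\<lambda>(i, xs). rotate i xs) ` ({..<k} \<times> G)"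
      proof
        fix xs assume xs: "xs \<in> T"
        then obtain i where i: "nonneg_prefixes f 0 (rotate i xs)"
          using ex_rotate_nonneg_prefixes weight by blast
        have k: "k > 0" using len[OF xs] weight[OF xs] by (cases xs) auto
        \<comment> \<open>This rotation undoes \<open>i\<close>; the outer \<open>mod\<close> keeps
          \<open>j < k\<close> when \<open>k\<close> divides \<open>i\<close>.\<close>
        define j where "j = (k - i mod k) mod k"
        have "(j + i) mod k = 0"
        proof (cases "i mod k = 0")
          case True
          then show ?thesis by (simp add: j_def)
        next
          case False
          then have "j = k - i mod k" using k by (simp add: j_def)
          then have "j + i = (k - i mod k + i mod k) + k * (i div k)"
            by simp
          then show ?thesis using k by (simp add: less_imp_le)
        qed
        then have "rotate j (rotate i xs) = xs"
          using len[OF xs] by (simp add: rotate_rotate rotate_id)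
        moreover have "rotate i xs \<in> G" using i closed xs by (simp add: G_def)
        moreover have "j < k" using k by (simp add: j_def)
        ultimately show "xs \<in> (\<lambda>(i, xs). rotate i xs) ` ({..<k} \<times> G)"
          by (intro image_eqI[where x = "(j, rotate i xs)"]) auto
      qed
    qed
  qed
  then have "card ({..<k} \<times> G) = card T" by (rule bij_betw_same_card)
  then show ?thesis by (simp add: G_def card_cartesian_product)
qed

section \<open>Compositions\<close>

definition compositions :: "nat \<Rightarrow> nat \<Rightarrow> nat list set" where
  "compositions k n = {xs. length xs = k \<and> (\<forall>x\<in>set xs. 0 < x) \<and> sum_list xs = n}"

lemma sum_list_map_Suc: "sum_list (map Suc xs) = sum_list xs + length xs"
  by (induction xs) auto

lemma pos_list_conv_map_Suc: "(\<forall>x\<in>set xs. 0 < x) \<longleftrightarrow> (\<exists>ys. xs = map Suc ys)"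
  by (auto simp: ex_map_conv gr0_conv_Suc)

lemma finite_compositions: "finite (compositions k n)"
proof (rule finite_subset)
  show "compositions k n \<subseteq> {xs. set xs \<subseteq> {..n} \<and> length xs = k}"
    by (auto simp: compositions_def member_le_sum_list)
  show "finite {xs. set xs \<subseteq> {..n} \<and> length xs = k}"
    by (rule finite_lists_length_eq) simp
qed

text \<open>Subtracting 1 from each part leaves lists of naturals with sum \<open>n - k\<close>,
  counted by stars and bars.\<close>

lemma card_compositions:
  assumes "0 < k" "k \<le> n"
  shows "card (compositions k n) = (n - 1) choose (k - 1)"
proof -
  have "compositions k n = map Suc ` {xs. length xs = k \<and> sum_list xs = n - k}"
    using assms by (auto simp: compositions_def pos_list_conv_map_Suc sum_list_map_Suc image_iff)
  then have "card (compositions k n) = card {xs::nat list. length xs = k \<and> sum_list xs = n - k}"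
    by (simp add: card_image inj_on_mapI)
  also have "\<dots> = (n - 1) choose (n - k)"
    using assms by (simp add: card_length_sum_list)
  also have "\<dots> = (n - 1) choose (k - 1)"
    using assms binomial_symmetric[of "k - 1" "n - 1"] by simp
  finally show ?thesis .
qed

lemma compositions_empty:
  assumes "n < k"
  shows "compositions k n = {}"
  using assms by (auto simp: compositions_def pos_list_conv_map_Suc sum_list_map_Suc)

lemma compositions_0: "compositions 0 n = (if n = 0 then {[]} else {})"
  by (auto simp: compositions_def)

text \<open>These are compositions with every part lowered by 1: parts that were at least 2 become
  the \<open>m\<close> positive entries, parts equal to 1 become zeros.\<close>

definition sparse_lists :: "nat \<Rightarrow> nat \<Rightarrow> nat \<Rightarrow> nat list set" where
  "sparse_lists k m s =
     {xs. length xs = k \<and> length (filter (\<lambda>x. 0 < x) xs) = m \<and> sum_list xs = s}"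

lemma sum_list_filter_pos: "sum_list (filter (\<lambda>x. 0 < x) xs) = sum_list (xs :: nat list)"
  by (induction xs) auto

text \<open>Once the positive entries and their order are fixed, only the positions of the zeros
  remain free; as \<open>shuffles\<close> of lists with no common element they are counted by a
  binomial coefficient.\<close>

lemma sparse_list_eq_shuffles:
  assumes "p \<in> compositions m s" "m \<le> k"
  shows "{xs. length xs = k \<and> filter (\<lambda>x. 0 < x) xs = p} = shuffles p (replicate (k - m) 0)"
    (is "?L = ?R")
proof
  have p: "length p = m" "\<And>x. x \<in> set p \<Longrightarrow> 0 < x"
    using assms(1) by (auto simp: compositions_def)
  show "?L \<subseteq> ?R"
  proof
    fix xs assume "xs \<in> ?L"
    then have xs: "length xs = k" "filter (\<lambda>x. 0 < x) xs = p" by auto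
    have "length (filter (\<lambda>x. \<not> 0 < x) xs) = k - m"
      using sum_length_filter_compl[of "\<lambda>x. 0 < x" xs] xs p by simp
    then have "filter (\<lambda>x. \<not> 0 < x) xs = replicate (k - m) 0"
      by (intro replicate_eqI) auto
    with partition_in_shuffles[of xs "\<lambda>x. 0 < x"] xs show "xs \<in> ?R" by simp
  qed
  show "?R \<subseteq> ?L"
  proof
    fix xs assume xs: "xs \<in> ?R"
    \<comment> \<open>Filtering commutes with shuffling and erases the zeros, so only
      \<open>p\<close> can be left.\<close>
    then have "filter (\<lambda>x. 0 < x) xs \<in>
        shuffles (filter (\<lambda>x. 0 < x) p) (filter (\<lambda>x. 0 < x) (replicate (k - m) 0))"
      unfolding filter_shuffles[symmetric] by blast
    then have "filter (\<lambda>x. 0 < x) xs = p"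
      using p by (simp add: filter_id_conv)
    with length_shuffles[OF xs] p assms(2) show "xs \<in> ?L" by simp
  qed
qed

text \<open>The lists are grouped by their subsequence \<open>p\<close> of positive entries, a
  composition of \<open>s\<close> into \<open>m\<close> parts; each fibre \<open>F p\<close> has
  \<open>k choose m\<close> elements.\<close>

lemma card_sparse_lists:
  "card (sparse_lists k m s) = (k choose m) * card (compositions m s)"
proof (cases "m \<le> k")
  case False
  then have "sparse_lists k m s = {}"
    by (auto simp: sparse_lists_def)
  with False show ?thesis by simp
next
  case True
  define F where "F p = {xs. length xs = k \<and> filter (\<lambda>x. 0 < x) xs = p}" for p :: "nat list"
  have F: "finite (F p) \<and> card (F p) = k choose m" if "p \<in> compositions m s" for p
  proof -
    have "set p \<inter> set (replicate (k - m) 0) = {}" "length p = m"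
      using that by (auto simp: compositions_def)
    then show ?thesis
      using sparse_list_eq_shuffles[OF that True] True
      by (simp add: F_def card_disjoint_shuffles)
  qed
  have "xs \<in> sparse_lists k m s \<longleftrightarrow>
      length xs = k \<and> filter (\<lambda>x. 0 < x) xs \<in> compositions m s" for xs
    unfolding sparse_lists_def compositions_def mem_Collect_eq sum_list_filter_pos by simp
  then have "sparse_lists k m s = (\<Union>p\<in>compositions m s. F p)"
    unfolding F_def by blast
  then have "card (sparse_lists k m s) = card (\<Union>p\<in>compositions m s. F p)"
    by (rule arg_cong)
  also have "\<dots> = (\<Sum>p\<in>compositions m s. card (F p))"
  proof (rule card_UN_disjoint)
    show "\<forall>p\<in>compositions m s. finite (F p)" using F by blast
    show "\<forall>p\<in>compositions m s. \<forall>q\<in>compositions m s. p \<noteq> q \<longrightarrow> F p \<inter> F q = {}"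
      unfolding F_def by blast
  qed (rule finite_compositions)
  also have "\<dots> = (\<Sum>p\<in>compositions m s. k choose m)"
    using F by (intro sum.cong) auto
  finally show ?thesis by simp
qed

lemma card_compositions_filter:
  assumes "k \<le> n"
  shows "card {xs \<in> compositions k n. length (filter (\<lambda>x. 2 \<le> x) xs) = m}
    = (k choose m) * card (compositions m (n - k))"
proof -
  have *: "length (filter (\<lambda>x. 2 \<le> x) (map Suc ys)) = length (filter (\<lambda>x. 0 < x) ys)" for ys
    by (induction ys) auto
  have "{xs \<in> compositions k n. length (filter (\<lambda>x. 2 \<le> x) xs) = m}
      = map Suc ` sparse_lists k m (n - k)"
    using assms * unfolding compositions_def pos_list_conv_map_Suc
    by (auto simp: sparse_lists_def sum_list_map_Suc)
  then show ?thesis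
    by (simp add: card_image inj_on_mapI card_sparse_lists)
qed

section \<open>Block decomposition of words\<close>

lemma factor_count_Nil: "f \<noteq> [] \<Longrightarrow> factor_count f [] = 0"
  by (simp add: factor_count_def)

lemma finite_factor_occurrences: "finite {(p, s). w = p @ f @ s}"
proof (rule finite_subset)
  show "{(p, s). w = p @ f @ s} \<subseteq>
      (\<lambda>i. (take i w, drop (i + length f) w)) ` {..length w}"
  proof
    fix x assume "x \<in> {(p, s). w = p @ f @ s}"
    then obtain p s where "x = (p, s)" "w = p @ f @ s" by blast
    then show "x \<in> (\<lambda>i. (take i w, drop (i + length f) w)) ` {..length w}"
      by (intro image_eqI[where x = "length p"]) auto
  qed
qed simp

text \<open>An occurrence with \<open>p = []\<close> sits at the front; any other comes from an
  occurrence in \<open>w\<close> by prepending \<open>x\<close> to \<open>p\<close>. The set-based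
  count thus becomes a recursion.\<close>

lemma factor_count_Cons:
  fixes f :: "'a list"
  assumes "f \<noteq> []"
  shows "factor_count f (x # w) = (if prefix f (x # w) then 1 else 0) + factor_count f w"
proof -
  define A where "A = {(p :: 'a list, s). p = [] \<and> x # w = f @ s}"
  define B where "B = (\<lambda>(p, s). (x # p, s)) ` {(p, s). w = p @ f @ s}"
  have "{(p, s). x # w = p @ f @ s} = A \<union> B"
    by (auto simp: A_def B_def Cons_eq_append_conv image_iff)
  moreover have "A \<inter> B = {}" by (auto simp: A_def B_def)
  moreover have "A = (if prefix f (x # w) then {([], drop (length f) (x # w))} else {})"
    by (auto simp: A_def prefix_def append_eq_conv_conj)
  moreover have "finite B" unfolding B_def by (intro finite_imageI finite_factor_occurrences)
  moreover have "card B = factor_count f w"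
    unfolding B_def factor_count_def by (rule card_image) (auto simp: inj_on_def)
  ultimately show ?thesis
    unfolding factor_count_def by (simp add: card_Un_disjoint)
qed

lemmas factor_count_simps = factor_count_Nil factor_count_Cons

section \<open>Words as sequences of blocks: uniqueness and existence\<close>

fun blocks_word :: "(nat \<times> nat) list \<Rightarrow> step list" where
  "blocks_word [] = []"
| "blocks_word ((a, b) # xs) = replicate a U @ replicate b D @ blocks_word xs"

definition pos_blocks :: "(nat \<times> nat) list \<Rightarrow> bool" where
  "pos_blocks xs \<longleftrightarrow> (\<forall>(a, b) \<in> set xs. 0 < a \<and> 0 < b)"

lemma pos_blocks_Nil [simp]: "pos_blocks []"
  by (simp add: pos_blocks_def)

lemma pos_blocks_Cons [simp]:
  "pos_blocks ((a, b) # xs) \<longleftrightarrow> 0 < a \<and> 0 < b \<and> pos_blocks xs"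
  by (auto simp: pos_blocks_def)

text \<open>The conditions on \<open>v\<close> and \<open>w\<close> make the run of \<open>c\<close>
  maximal, so \<open>takeWhile\<close> recovers its length.\<close>

lemma replicate_append_eq_iff:
  assumes "c \<noteq> d" "v = [] \<or> hd v = d" "w = [] \<or> hd w = d"
  shows "replicate i c @ v = replicate j c @ w \<longleftrightarrow> i = j \<and> v = w"
proof -
  have *: "takeWhile ((=) c) (replicate i c @ v) = replicate i c"
    if "v = [] \<or> hd v = d" for v i
    using that assms(1) by (cases v) (auto simp: takeWhile_append)
  show ?thesis
  proof
    assume "replicate i c @ v = replicate j c @ w"
    moreover from this have "replicate i c = replicate j c"
      using *[of v i] *[of w j] assms(2,3) by simp
    then have "i = j" by (metis length_replicate)
    ultimately show "i = j \<and> v = w" by simp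
  qed simp
qed

lemma hd_blocks_word:
  assumes "pos_blocks xs"
  shows "blocks_word xs = [] \<or> hd (blocks_word xs) = U"
  using assms by (cases xs rule: blocks_word.cases) (auto simp: gr0_conv_Suc)

text \<open>Positive run lengths make every run maximal, so the two runs of the first block can be
  read off and removed one after the other.\<close>

lemma inj_on_blocks_word: "inj_on blocks_word {xs. pos_blocks xs}"
proof (rule inj_onI, simp)
  fix xs ys
  show "pos_blocks xs \<Longrightarrow> pos_blocks ys \<Longrightarrow> blocks_word xs = blocks_word ys \<Longrightarrow> xs = ys"
  proof (induction xs arbitrary: ys rule: blocks_word.induct)
    case 1
    then show ?case by (cases ys rule: blocks_word.cases) auto
  next
    case (2 a b xs)
    from "2.prems" obtain c d zs where ys: "ys = (c, d) # zs"
      by (cases ys rule: blocks_word.cases) auto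
    have pos: "0 < b" "0 < d" "pos_blocks xs" "pos_blocks zs" using "2.prems" ys by auto
    have hd: "hd (replicate e D @ v) = D" if "0 < e" for e v
      using that by (auto simp: gr0_conv_Suc)
    have "a = c \<and> replicate b D @ blocks_word xs = replicate d D @ blocks_word zs"
      using "2.prems"(3) pos hd unfolding ys
      by (subst replicate_append_eq_iff[of U D, symmetric]) auto
    moreover from this have "b = d \<and> blocks_word xs = blocks_word zs"
      using pos hd_blocks_word
      by (subst replicate_append_eq_iff[of D U, symmetric]) auto
    ultimately show ?case using "2.IH" pos ys by auto
  qed
qed

text \<open>The induction prepends letters, so a leading run of \<open>D\<close> not yet preceded by
  a \<open>U\<close> has to be allowed; \<open>b\<close> may be 0.\<close>

lemma ex_blocks_word:
  assumes "w = [] \<or> last w = D"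
  shows "\<exists>b xs. pos_blocks xs \<and> w = replicate b D @ blocks_word xs"
  using assms
proof (induction w)
  case Nil
  have "[] = replicate 0 D @ blocks_word []" by simp
  then show ?case using pos_blocks_Nil by blast
next
  case (Cons x w)
  then have "w = [] \<or> last w = D" by (auto split: if_splits)
  with Cons.IH obtain b xs where IH: "pos_blocks xs" "w = replicate b D @ blocks_word xs" by blast
  show ?case
  proof (cases x)
    case D
    then have "x # w = replicate (Suc b) D @ blocks_word xs" using IH by simp
    then show ?thesis using IH by blast
  next
    case U
    with Cons.prems have "w \<noteq> []" by auto
    show ?thesis
    \<comment> \<open>A new \<open>U\<close> in front of a nonempty \<open>D\<close> run closes it
      into a block \<open>(1, b)\<close>; otherwise it lengthens the \<open>U\<close> run of the
      first block.\<close>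
    proof (cases "b = 0")
      case False
      then have "pos_blocks ((1, b) # xs)"
        "x # w = replicate 0 D @ blocks_word ((1, b) # xs)"
        using IH U by auto
      then show ?thesis by blast
    next
      case True
      with IH \<open>w \<noteq> []\<close> obtain a c zs where xs: "xs = (a, c) # zs"
        by (cases xs rule: blocks_word.cases) auto
      then have "pos_blocks ((Suc a, c) # zs)"
        "x # w = replicate 0 D @ blocks_word ((Suc a, c) # zs)"
        using IH U True by auto
      then show ?thesis by blast
    qed
  qed
qed

section \<open>Letter and factor counts of block words\<close>

lemma count_list_replicate: "count_list (replicate a x) y = (if x = y then a else 0)"
  by (induction a) auto

lemma count_U_blocks_word: "count_list (blocks_word xs) U = sum_list (map fst xs)"
  by (induction xs rule: blocks_word.induct) (auto simp: count_list_replicate)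

lemma count_D_blocks_word: "count_list (blocks_word xs) D = sum_list (map snd xs)"
  by (induction xs rule: blocks_word.induct) (auto simp: count_list_replicate)

lemma factor_count_replicate_D:
  "factor_count (U # f) (replicate b D @ w) = factor_count (U # f) w"
  by (induction b) (auto simp: factor_count_simps)

text \<open>The only peak of the block starts at its last \<open>U\<close>; every earlier
  \<open>U\<close> is followed by a \<open>U\<close>.\<close>

lemma factor_count_UD_block:
  assumes "0 < a" "0 < b"
  shows "factor_count [U, D] (replicate a U @ replicate b D @ w) = Suc (factor_count [U, D] w)"
proof -
  from assms obtain c where c: "b = Suc c" by (auto simp: gr0_conv_Suc)
  from assms(1) show ?thesis
  proof (induction a rule: nat_induct_non_zero)
    case 1
    then show ?case by (simp add: c factor_count_simps factor_count_replicate_D)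
  next
    case (Suc a)
    then show ?case by (auto simp: factor_count_simps gr0_conv_Suc)
  qed
qed

text \<open>Within the block the factor can only end at the first \<open>D\<close>, and two letters
  \<open>U\<close> must precede it.\<close>

lemma factor_count_UUD_block:
  assumes "0 < a" "0 < b"
  shows "factor_count [U, U, D] (replicate a U @ replicate b D @ w)
    = (if 2 \<le> a then 1 else 0) + factor_count [U, U, D] w"
proof -
  from assms obtain c where c: "b = Suc c" by (auto simp: gr0_conv_Suc)
  have 1: "factor_count [U, U, D] (U # replicate b D @ w) = factor_count [U, U, D] w"
    by (simp add: c factor_count_simps factor_count_replicate_D)
  have 2: "factor_count [U, U, D] (replicate (Suc (Suc e)) U @ replicate b D @ w)
      = Suc (factor_count [U, U, D] w)" for e
  proof (induction e)
    case 0
    then show ?case using 1 by (simp add: factor_count_Cons[of _ U] c)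
  next
    case (Suc e)
    then show ?case by (simp add: factor_count_Cons[of _ U "U # U # _"])
  qed
  show ?thesis
  proof (cases "2 \<le> a")
    case True
    then obtain e where "a = Suc (Suc e)" by (metis Suc_le_D numeral_2_eq_2 Suc_le_mono)
    then show ?thesis using 2 by simp
  next
    case False
    with assms have "a = 1" by simp
    then show ?thesis using 1 by simp
  qed
qed

lemma factor_count_UD_blocks_word:
  "pos_blocks xs \<Longrightarrow> factor_count [U, D] (blocks_word xs) = length xs"
  by (induction xs rule: blocks_word.induct) (auto simp: factor_count_UD_block factor_count_Nil)

lemma factor_count_UUD_blocks_word:
  "pos_blocks xs \<Longrightarrow>
    factor_count [U, U, D] (blocks_word xs) = length (filter (\<lambda>x. 2 \<le> x) (map fst xs))"
  by (induction xs rule: blocks_word.induct) (auto simp: factor_count_UUD_block factor_count_Nil)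

text \<open>A new occurrence would end in the appended \<open>D\<close> and hence have
  \<open>U\<close> just before it, but that letter is \<open>D\<close>.\<close>

lemma factor_count_snoc_D:
  assumes "w \<noteq> []" "last w = D"
  shows "factor_count [U, D] (w @ [D]) = factor_count [U, D] w"
    and "factor_count [U, U, D] (w @ [D]) = factor_count [U, U, D] w"
proof -
  from assms obtain v where w: "w = v @ [D]" by (metis append_butlast_last_id)
  have UD: "prefix [U, D] (x # v @ [D, D]) \<longleftrightarrow> prefix [U, D] (x # v @ [D])" for x v
    by (cases v) auto
  have UUD: "prefix [U, U, D] (x # v @ [D, D]) \<longleftrightarrow> prefix [U, U, D] (x # v @ [D])" for x v
    by (cases v; cases "tl v") auto
  have "factor_count [U, D] (v @ [D, D]) = factor_count [U, D] (v @ [D])"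
    by (induction v) (use UD in \<open>auto simp: factor_count_simps\<close>)
  moreover have "factor_count [U, U, D] (v @ [D, D]) = factor_count [U, U, D] (v @ [D])"
    by (induction v) (use UUD in \<open>auto simp: factor_count_simps\<close>)
  ultimately show "factor_count [U, D] (w @ [D]) = factor_count [U, D] w"
    "factor_count [U, U, D] (w @ [D]) = factor_count [U, U, D] w"
    by (simp_all add: w)
qed

section \<open>Dyck paths as block sequences\<close>

fun step_height :: "step \<Rightarrow> int" where
  "step_height U = 1"
| "step_height D = -1"

definition block_height :: "nat \<times> nat \<Rightarrow> int" where
  "block_height x = int (fst x) - int (snd x)"

lemma sum_step_height:
  "sum_list (map step_height w) = int (count_list w U) - int (count_list w D)"
proof (induction w)
  case (Cons x w)
  then show ?case by (cases x) auto
qed simp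

lemma sum_block_height:
  "sum_list (map block_height xs) = int (sum_list (map fst xs)) - int (sum_list (map snd xs))"
  by (induction xs) (auto simp: block_height_def)

text \<open>The strict prefixes of \<open>w @ [D]\<close> are exactly the prefixes of
  \<open>w\<close>; this brings the path condition into the form used by the cycle lemma.\<close>

lemma dyck_path_iff_nonneg_prefixes:
  "dyck_path n w \<longleftrightarrow> count_list w U = n \<and> count_list w D = n \<and>
    nonneg_prefixes step_height 0 (w @ [D])"
proof -
  have "strict_prefix p (w @ [D]) \<longleftrightarrow> prefix p w" for p
    by (auto simp: strict_prefix_def)
  then show ?thesis
    by (auto simp: dyck_path_def nonneg_prefixes_def sum_step_height)
qed

lemma nonneg_prefixes_replicate_U:
  "0 < a \<Longrightarrow> nonneg_prefixes step_height h (replicate a U @ w) \<longleftrightarrow>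
    0 \<le> h \<and> nonneg_prefixes step_height (h + int a) w"
proof (induction a arbitrary: h rule: nat_induct_non_zero)
  case (Suc a)
  then show ?case by (simp add: add.assoc) linarith
qed simp

text \<open>The heights tested in the run are \<open>h\<close> down to \<open>h - b + 1\<close>; the
  height \<open>h - b\<close> after it is left to \<open>w\<close>, whence the
  \<open>+ 1\<close>.\<close>

lemma nonneg_prefixes_replicate_D:
  "0 < b \<Longrightarrow> nonneg_prefixes step_height h (replicate b D @ w) \<longleftrightarrow>
    int b \<le> h + 1 \<and> nonneg_prefixes step_height (h - int b) w"
proof (induction b arbitrary: h rule: nat_induct_non_zero)
  case (Suc b)
  then show ?case using Suc.IH[of "h - 1"] by (auto simp: diff_diff_eq)
qed simp

text \<open>Heights rise and then fall within a block, so the lowest points lie at block boundaries.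
  The total of -1 controls the descent of the last block.\<close>

lemma nonneg_prefixes_blocks_word:
  assumes "pos_blocks xs" "h + sum_list (map block_height xs) = -1"
  shows "nonneg_prefixes step_height h (blocks_word xs) \<longleftrightarrow> nonneg_prefixes block_height h xs"
  using assms
proof (induction xs arbitrary: h rule: blocks_word.induct)
  case (2 a b xs)
  have h: "h + block_height (a, b) = h + int a - int b"
    by (simp add: block_height_def)
  \<comment> \<open>The \<open>D\<close> run of the block requires just this bound. After the last
    block the height is exactly -1 by the sum hypothesis; before any further block it is even
    nonnegative.\<close>
  have "-1 \<le> h + int a - int b"
    if "nonneg_prefixes block_height (h + int a - int b) xs"
  proof (cases xs)
    case Nil
    then show ?thesis using "2.prems"(2) h by simp
  next
    case (Cons x zs)
    then show ?thesis using that by simp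
  qed
  moreover have "nonneg_prefixes step_height (h + int a - int b) (blocks_word xs) \<longleftrightarrow>
      nonneg_prefixes block_height (h + int a - int b) xs"
    using "2.prems" h by (intro "2.IH") (auto simp: add.assoc)
  ultimately show ?case
    using "2.prems" h by (auto simp: nonneg_prefixes_replicate_U nonneg_prefixes_replicate_D add_diff_eq)
qed simp

text \<open>The rotation-closed set for the cycle lemma, with the path condition dropped;
  \<open>n + 1\<close> accounts for the appended \<open>D\<close>.\<close>

definition block_seqs :: "nat \<Rightarrow> nat \<Rightarrow> nat \<Rightarrow> (nat \<times> nat) list set" where
  "block_seqs n k m = {xs. map fst xs \<in> compositions k n \<and>
     length (filter (\<lambda>x. 2 \<le> x) (map fst xs)) = m \<and> map snd xs \<in> compositions k (n + 1)}"

lemma mem_block_seqs: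
  "xs \<in> block_seqs n k m \<longleftrightarrow> length xs = k \<and> pos_blocks xs \<and> sum_list (map fst xs) = n \<and>
    sum_list (map snd xs) = n + 1 \<and> length (filter (\<lambda>x. 2 \<le> x) (map fst xs)) = m"
  by (fastforce simp: block_seqs_def compositions_def pos_blocks_def)

text \<open>Without the path condition, the \<open>U\<close> run lengths and the \<open>D\<close>
  run lengths are independent choices.\<close>

lemma zip_block_seqs:
  "bij_betw (\<lambda>xs. (map fst xs, map snd xs)) (block_seqs n k m)
    ({xs \<in> compositions k n. length (filter (\<lambda>x. 2 \<le> x) xs) = m} \<times> compositions k (n + 1))"
proof (rule bij_betw_byWitness[where f' = "\<lambda>(as, bs). zip as bs"])
  show "\<forall>xs\<in>block_seqs n k m.
      (case (map fst xs, map snd xs) of (as, bs) \<Rightarrow> zip as bs) = xs"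
    by (simp add: zip_map_fst_snd)
  show "(\<lambda>(as, bs). zip as bs) `
      ({xs \<in> compositions k n. length (filter (\<lambda>x. 2 \<le> x) xs) = m} \<times> compositions k (n + 1))
    \<subseteq> block_seqs n k m"
  proof clarify
    fix as bs assume *: "as \<in> compositions k n" "bs \<in> compositions k (n + 1)"
    then have "map fst (zip as bs) = as" "map snd (zip as bs) = bs"
      by (auto simp: compositions_def)
    with * show "zip as bs \<in> block_seqs n k (length (filter (\<lambda>x. 2 \<le> x) as))"
      unfolding block_seqs_def mem_Collect_eq by metis
  qed
qed (auto simp: block_seqs_def compositions_def)

lemma card_block_seqs:
  assumes "k \<le> n"
  shows "card (block_seqs n k m) =
    (k choose m) * card (compositions m (n - k)) * card (compositions k (n + 1))"
  using bij_betw_same_card[OF zip_block_seqs] card_compositions_filter[OF assms]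
  by (simp add: card_cartesian_product)

lemma block_seqs_empty:
  assumes "n < k"
  shows "block_seqs n k m = {}"
  using compositions_empty[OF assms] by (simp add: block_seqs_def)

lemma finite_block_seqs: "finite (block_seqs n k m)"
  using bij_betw_finite[OF zip_block_seqs] finite_compositions by simp

lemma rotate_block_seqs:
  assumes "xs \<in> block_seqs n k m"
  shows "rotate i xs \<in> block_seqs n k m"
proof -
  have *: "sum_list (rotate i ys) = sum_list ys"
    "length (filter P (rotate i ys)) = length (filter P ys)" for P and ys :: "nat list"
  proof -
    have 1: "sum_list (rotate1 zs) = sum_list zs \<and>
        length (filter P (rotate1 zs)) = length (filter P zs)" for zs :: "nat list"
      by (cases zs) auto
    show "sum_list (rotate i ys) = sum_list ys"
      "length (filter P (rotate i ys)) = length (filter P ys)"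
      by (induction i) (simp_all add: 1)
  qed
  show ?thesis
    using assms by (simp add: mem_block_seqs pos_blocks_def rotate_map[symmetric] *)
qed

section \<open>Matching Dyck paths with block sequences\<close>

lemma last_dyck_path:
  assumes "dyck_path n w" "w \<noteq> []"
  shows "last w = D"
proof (rule ccontr)
  assume "last w \<noteq> D"
  then have "last w = U" by (cases "last w") auto
  with assms(2) obtain v where "w = v @ [U]" by (metis append_butlast_last_id)
  with assms(1) show False by (auto simp: dyck_path_def)
qed

text \<open>For \<open>0 < k\<close> the path is nonempty, so it starts with \<open>U\<close> and
  ends with \<open>D\<close>: its extension splits into blocks without a leading \<open>D\<close>
  run, and the extra \<open>D\<close> leaves both factor counts unchanged.\<close>

lemma dyck_paths_snoc_eq_blocks:
  assumes "0 < k"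
  shows "(\<lambda>w. w @ [D]) `
      {w. dyck_path n w \<and> factor_count [U, D] w = k \<and> factor_count [U, U, D] w = m}
    = blocks_word ` {xs \<in> block_seqs n k m. nonneg_prefixes block_height 0 xs}"
proof (intro equalityI subsetI)
  fix w' assume "w' \<in> (\<lambda>w. w @ [D]) `
      {w. dyck_path n w \<and> factor_count [U, D] w = k \<and> factor_count [U, U, D] w = m}"
  then obtain w where w: "w' = w @ [D]" "dyck_path n w"
    "factor_count [U, D] w = k" "factor_count [U, U, D] w = m" by blast
  have ne: "w \<noteq> []" using w(3) assms by (auto simp: factor_count_Nil)
  obtain b xs where xs: "pos_blocks xs" "w @ [D] = replicate b D @ blocks_word xs"
    using ex_blocks_word[of "w @ [D]"] by auto
  have "b = 0"
  proof (rule ccontr)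
    assume "b \<noteq> 0"
    then have "hd (w @ [D]) = D" using xs(2) by (cases b) auto
    with ne obtain v where "w = D # v" by (cases w) auto
    then have "prefix [D] w" by simp
    with w(2) show False by (fastforce simp: dyck_path_def)
  qed
  with xs have w': "w @ [D] = blocks_word xs" by simp
  note fc = factor_count_snoc_D[OF ne last_dyck_path[OF w(2) ne]]
  have U: "sum_list (map fst xs) = n"
    using w(2) by (simp add: count_U_blocks_word[symmetric] w'[symmetric] dyck_path_def)
  have D: "sum_list (map snd xs) = n + 1"
    using w(2) by (simp add: count_D_blocks_word[symmetric] w'[symmetric] dyck_path_def)
  have "xs \<in> block_seqs n k m"
    using U D fc w(3,4) xs(1) factor_count_UD_blocks_word[OF xs(1)]
      factor_count_UUD_blocks_word[OF xs(1)]
    by (simp add: mem_block_seqs w')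
  moreover have "nonneg_prefixes block_height 0 xs"
    using w(2) nonneg_prefixes_blocks_word[OF xs(1), of 0] U D
    by (simp add: sum_block_height dyck_path_iff_nonneg_prefixes w')
  ultimately show "w' \<in> blocks_word ` {xs \<in> block_seqs n k m. nonneg_prefixes block_height 0 xs}"
    using w(1) w' by auto
next
  fix w' assume "w' \<in> blocks_word ` {xs \<in> block_seqs n k m. nonneg_prefixes block_height 0 xs}"
  then obtain xs where w': "w' = blocks_word xs" and xs: "xs \<in> block_seqs n k m"
    and nn: "nonneg_prefixes block_height 0 xs" by blast
  from xs have pos: "pos_blocks xs" and len: "length xs = k"
    and U: "sum_list (map fst xs) = n" and D: "sum_list (map snd xs) = n + 1"
    and m: "length (filter (\<lambda>x. 2 \<le> x) (map fst xs)) = m"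
    by (auto simp: mem_block_seqs)
  have "xs \<noteq> []" using len assms by auto
  then have "blocks_word xs \<noteq> [] \<and> last (blocks_word xs) = D" using pos
  proof (induction xs rule: blocks_word.induct)
    case (2 a b xs)
    then show ?case by (cases "xs = []") (auto simp: last_append)
  qed simp
  then obtain w where w: "blocks_word xs = w @ [D]" by (metis append_butlast_last_id)
  have dyck: "dyck_path n w"
    using count_U_blocks_word[of xs] count_D_blocks_word[of xs] U D nn
      nonneg_prefixes_blocks_word[OF pos, of 0]
    by (simp add: dyck_path_iff_nonneg_prefixes w sum_block_height)
  \<comment> \<open>In this direction \<open>w\<close> must be shown nonempty before its last letter
    can be used to discount the appended \<open>D\<close>.\<close>
  have "0 < n" using \<open>xs \<noteq> []\<close> pos U by (cases xs rule: blocks_word.cases) auto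
  then have ne: "w \<noteq> []" using dyck by (auto simp: dyck_path_def)
  have "factor_count [U, D] w = k" "factor_count [U, U, D] w = m"
    using factor_count_UD_blocks_word[OF pos] factor_count_UUD_blocks_word[OF pos] len m
      factor_count_snoc_D[OF ne last_dyck_path[OF dyck ne]] w by simp_all
  then show "w' \<in> (\<lambda>w. w @ [D]) `
      {w. dyck_path n w \<and> factor_count [U, D] w = k \<and> factor_count [U, U, D] w = m}"
    using dyck w w' by auto
qed

text \<open>Appending \<open>D\<close> and \<open>blocks_word\<close> are both injective here, so
  the good block sequences are counted by \<open>dyck_count\<close>; the block weights sum to
  \<open>n - (n + 1) = -1\<close>.\<close>

lemma dyck_count_cycle:
  assumes "0 < k"
  shows "k * dyck_count n k m = card (block_seqs n k m)"
proof -
  let ?G = "{xs \<in> block_seqs n k m. nonneg_prefixes block_height 0 xs}"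
  have "inj_on blocks_word ?G"
    by (rule inj_on_subset[OF inj_on_blocks_word]) (auto simp: mem_block_seqs)
  then have "card ?G = card (blocks_word ` ?G)" by (simp add: card_image)
  also have "\<dots> = dyck_count n k m"
    unfolding dyck_paths_snoc_eq_blocks[OF assms, symmetric] dyck_count_def
    by (rule card_image) (auto simp: inj_on_def)
  finally have "card ?G = dyck_count n k m" .
  moreover have "card (block_seqs n k m) = k * card ?G"
    using finite_block_seqs rotate_block_seqs
    by (intro cycle_lemma) (auto simp: mem_block_seqs sum_block_height)
  ultimately show ?thesis by simp
qed

text \<open>Division by \<open>k\<close> is impossible here, so this case has its own argument:
  without peaks the block decomposition is a mere run of \<open>D\<close>, which is a Dyck path only
  if empty.\<close>

lemma dyck_count_no_peaks: "dyck_count n 0 m = (if n = 0 \<and> m = 0 then 1 else 0)"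
proof -
  have nil: "w = []" if dyck: "dyck_path n w" and peaks: "factor_count [U, D] w = 0" for w
  proof (rule ccontr)
    assume ne: "w \<noteq> []"
    obtain b xs where xs: "pos_blocks xs" "w = replicate b D @ blocks_word xs"
      using ex_blocks_word[of w] last_dyck_path[OF dyck ne] by blast
    have "xs = []"
      using peaks xs factor_count_UD_blocks_word[OF xs(1)]
      by (simp add: factor_count_replicate_D)
    then have "w = replicate b D" using xs by simp
    with dyck ne show False by (auto simp: dyck_path_def count_list_replicate)
  qed
  have "dyck_path n w \<and> factor_count [U, D] w = 0 \<and> factor_count [U, U, D] w = m
      \<longleftrightarrow> w = [] \<and> n = 0 \<and> m = 0" for w
    using nil[of w] by (cases "w = []") (auto simp: factor_count_Nil dyck_path_def)
  then show ?thesis by (simp add: dyck_count_def)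
qed

theorem theorem1p2:
  fixes n k m :: nat
  shows "real (dyck_count n k m) =
    (if m > 0 \<and> m \<le> k \<and> k + m \<le> n then
       1 / real k * real (n choose (k - 1)) * real ((n - k - 1) choose (m - 1)) * real (k choose m)
     else if m = 0 \<and> n = k then 1
     else 0)"
proof (cases "k = 0")
  case True
  then show ?thesis by (auto simp: dyck_count_no_peaks)
next
  case False
  then have k: "0 < k" by simp
  note cyc = dyck_count_cycle[OF k, of n m]
  show ?thesis
  proof (cases "k \<le> n")
    case False
    then show ?thesis using cyc k by (simp add: block_seqs_empty)
  next
    case True
    have B: "card (compositions k (n + 1)) = n choose (k - 1)"
      using k True by (simp add: card_compositions)
    have eq: "k * dyck_count n k m =
        (k choose m) * card (compositions m (n - k)) * (n choose (k - 1))"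
      using cyc card_block_seqs[OF True] B by simp
    \<comment> \<open>In the last two cases a factor of \<open>eq\<close> vanishes:
      \<open>k choose m\<close> if \<open>k < m\<close>, the number of compositions of
      \<open>n - k\<close> if \<open>n < k + m\<close>.\<close>
    consider "m = 0" | "0 < m" "m \<le> k" "k + m \<le> n" | "k < m" | "0 < m" "n < k + m"
      by linarith
    then show ?thesis
    proof cases
      case 1
      \<comment> \<open>For \<open>m = 0\<close> only \<open>n = k\<close> survives, where the right
        side of \<open>eq\<close> is \<open>k choose (k - 1) = k\<close> and cancels to the count
        1.\<close>
      have "k choose (k - 1) = k" using k binomial_symmetric[of 1 k] by simp
      with eq 1 k True show ?thesis by (auto simp: compositions_0)
    next
      case 2
      then have "card (compositions m (n - k)) = (n - k - 1) choose (m - 1)"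
        by (intro card_compositions) auto
      with eq have "real k * real (dyck_count n k m) =
          real (k choose m) * real ((n - k - 1) choose (m - 1)) * real (n choose (k - 1))"
        by (metis of_nat_mult)
      with 2 k show ?thesis by (simp add: field_simps)
    next
      case 3
      with eq k show ?thesis by (simp add: binomial_eq_0)
    next
      case 4
      then have "compositions m (n - k) = {}" using True by (intro compositions_empty) auto
      with eq k 4 show ?thesis by simp
    qed
  qed
qed

end
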